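(* Let $\mathfrak{X}=(X,\{R_i\}_{i=0}^d)$ be a symmetric association scheme of class $d\ge 2$ with primitive idempotents $E_0=|X|^{-1}J,E_1,\ldots,E_d$, and let $\theta_j^\ast=q_1(j)$ for $0\le j\le d$. Suppose that $\theta_0^\ast,\theta_1^\ast,\ldots,\theta_d^\ast$ are mutually distinct. Then the following are equivalent: (1) $\mathfrak{X}$ is a $Q$-polynomial scheme with respect to $E_1$. (2) There exists $l\in\{2,3,\ldots,d\}$ such that for every $i\in\{1,2,\ldots,d\}$, \[\prod_{\substack{j=1\\ j\neq i}}^d \frac{\theta_0^\ast-\theta_j^\ast}{\theta_i^\ast-\theta_j^\ast}=-p_i(l).\] Moreover, if (2) holds, then $l=i_d$, where $E_0,E_1,E_{i_2},\ldots,E_{i_d}$ is the $Q$-polynomial ordering from (1).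
   Context: A symmetric association scheme of class $d$ is a pair $(X,\{R_i\}_{i=0}^d)$ with $X$ finite, each $R_i$ a nonempty subset of $X\times X$, $R_0=\{(x,x)\}$, the $R_i$ partition $X\times X$, each $R_i$ symmetric, and for all $i,j,k$ there is an integer $p_{ij}^k$ equal to $|\{z:(x,z)\in R_i,(z,y)\in R_j\}|$ for every $(x,y)\in R_k$. The adjacency matrix $A_i$ is the $X\times X$ 0/1 matrix with $(x,y)$-entry $1$ iff $(x,y)\in R_i$. The Bose--Mesner algebra (spanned by the $A_i$ over $\mathbb{C}$) has a basis of primitive idempotents $E_0,\ldots,E_d$ with $E_0=|X|^{-1}J$ ($J$ the all-ones matrix), $\sum_i E_i=I$, $E_iE_j=\delta_{ij}E_i$. The numbers $p_i(j)$ and $q_i(j)$ are defined by $A_i=\sum_{j=0}^d p_i(j)E_j$ and $E_i=|X|^{-1}\sum_{j=0}^d q_i(j)A_j$. The scheme is $Q$-polynomial with respect to an ordering $E_0,E_{i_1},\ldots,E_{i_d}$ if for each $h$ there is a polynomial $v_h^\ast$ of degree $h$ with $q_{i_h}(j)=v_h^\ast(q_{i_1}(j))$ for all $j$; it is $Q$-polynomial with respect to $E_1$ if it is $Q$-polynomial with respect to some ordering $E_0,E_1,E_{i_2},\ldots,E_{i_d}$. *)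

theory Defs
  imports "HOL-Analysis.Analysis" "HOL-Computational_Algebra.Polynomial"
begin

text \<open>The point set \<open>X\<close> is the universe of a finite type \<open>'x\<close>. The relations are given by a family
  indexed by \<^typ>\<open>nat\<close> of which only the members with index at most \<open>d\<close> matter; the same holds for
  families of matrices.\<close>

definition symmetric_association_scheme :: "nat \<Rightarrow> (nat \<Rightarrow> ('x::finite \<times> 'x) set) \<Rightarrow> bool" where
  "symmetric_association_scheme d R \<longleftrightarrow>
     (\<forall>i\<le>d. R i \<noteq> {}) \<and>
     R 0 = Id \<and>
     (\<Union>i\<le>d. R i) = UNIV \<and>
     (\<forall>i\<le>d. \<forall>j\<le>d. i \<noteq> j \<longrightarrow> R i \<inter> R j = {}) \<and>
     (\<forall>i\<le>d. sym (R i)) \<and>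
     (\<forall>i\<le>d. \<forall>j\<le>d. \<forall>k\<le>d. \<exists>p::nat. \<forall>(x, y)\<in>R k.
        card {z. (x, z) \<in> R i \<and> (z, y) \<in> R j} = p)"

definition adjacency_matrix :: "('x::finite \<times> 'x) set \<Rightarrow> complex^'x^'x" where
  "adjacency_matrix r = (\<chi> x y. if (x, y) \<in> r then 1 else 0)"

definition all_ones :: "complex^'x^'x::finite" where
  "all_ones = (\<chi> x y. 1)"

definition mscale :: "complex \<Rightarrow> complex^'x^'x \<Rightarrow> complex^'x^'x::finite" where
  "mscale c M = (\<chi> x y. c * M $ x $ y)"

definition lin_comb :: "nat \<Rightarrow> (nat \<Rightarrow> complex) \<Rightarrow> (nat \<Rightarrow> complex^'x^'x) \<Rightarrow> complex^'x^'x::finite" where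
  "lin_comb d c M = (\<Sum>i\<le>d. mscale (c i) (M i))"

definition bose_mesner :: "nat \<Rightarrow> (nat \<Rightarrow> ('x::finite \<times> 'x) set) \<Rightarrow> (complex^'x^'x) set" where
  "bose_mesner d R = range (\<lambda>c. lin_comb d c (\<lambda>i. adjacency_matrix (R i)))"

definition is_basis :: "nat \<Rightarrow> (nat \<Rightarrow> complex^'x^'x) \<Rightarrow> (complex^'x^'x::finite) set \<Rightarrow> bool" where
  "is_basis d M S \<longleftrightarrow>
     range (\<lambda>c. lin_comb d c M) = S \<and> (\<forall>c. lin_comb d c M = 0 \<longrightarrow> (\<forall>i\<le>d. c i = 0))"

definition primitive_idempotent :: "(complex^'x^'x) set \<Rightarrow> complex^'x^'x::finite \<Rightarrow> bool" where
  "primitive_idempotent S e \<longleftrightarrow>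
     e \<in> S \<and> e \<noteq> 0 \<and> e ** e = e \<and>
     (\<forall>f\<in>S. \<forall>g\<in>S. f ** f = f \<and> g ** g = g \<and> f ** g = 0 \<and> g ** f = 0 \<and> e = f + g
        \<longrightarrow> f = 0 \<or> g = 0)"

definition primitive_idempotents ::
    "nat \<Rightarrow> (nat \<Rightarrow> ('x::finite \<times> 'x) set) \<Rightarrow> (nat \<Rightarrow> complex^'x^'x) \<Rightarrow> bool" where
  "primitive_idempotents d R E \<longleftrightarrow>
     is_basis d E (bose_mesner d R) \<and>
     (\<forall>i\<le>d. primitive_idempotent (bose_mesner d R) (E i)) \<and>
     E 0 = mscale (1 / of_nat CARD('x)) all_ones \<and>
     (\<Sum>i\<le>d. E i) = mat 1 \<and>
     (\<forall>i\<le>d. \<forall>j\<le>d. E i ** E j = (if i = j then E i else 0))"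

text \<open>The numbers \<open>p\<^sub>i(j)\<close> and \<open>q\<^sub>i(j)\<close> are \<open>p_num d R E i j\<close> and \<open>q_num d R E i j\<close>; setting them to \<open>0\<close>
  for \<open>j > d\<close> makes the coefficient functions unique.\<close>

definition p_num :: "nat \<Rightarrow> (nat \<Rightarrow> ('x::finite \<times> 'x) set) \<Rightarrow> (nat \<Rightarrow> complex^'x^'x) \<Rightarrow> nat \<Rightarrow> nat \<Rightarrow> complex"
  where
  "p_num d R E i = (THE c. (\<forall>j>d. c j = 0) \<and> adjacency_matrix (R i) = lin_comb d c E)"

definition q_num :: "nat \<Rightarrow> (nat \<Rightarrow> ('x::finite \<times> 'x) set) \<Rightarrow> (nat \<Rightarrow> complex^'x^'x) \<Rightarrow> nat \<Rightarrow> nat \<Rightarrow> complex"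
  where
  "q_num d R E i = (THE c. (\<forall>j>d. c j = 0) \<and>
     E i = mscale (1 / of_nat CARD('x)) (lin_comb d c (\<lambda>j. adjacency_matrix (R j))))"

text \<open>The ordering \<open>E\<^sub>0, E\<^bsub>i\<^sub>1\<^esub>, \<dots>, E\<^bsub>i\<^sub>d\<^esub>\<close> is encoded by the function \<open>\<sigma> h = i\<^sub>h\<close> with \<open>\<sigma> 0 = 0\<close>.\<close>

definition Q_polynomial_ordering ::
    "nat \<Rightarrow> (nat \<Rightarrow> ('x::finite \<times> 'x) set) \<Rightarrow> (nat \<Rightarrow> complex^'x^'x) \<Rightarrow> (nat \<Rightarrow> nat) \<Rightarrow> bool" where
  "Q_polynomial_ordering d R E \<sigma> \<longleftrightarrow>
     bij_betw \<sigma> {..d} {..d} \<and> \<sigma> 0 = 0 \<and>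
     (\<forall>h\<le>d. \<exists>v :: complex poly. degree v = h \<and>
        (\<forall>j\<le>d. q_num d R E (\<sigma> h) j = poly v (q_num d R E (\<sigma> 1) j)))"

definition Q_polynomial_wrt ::
    "nat \<Rightarrow> (nat \<Rightarrow> ('x::finite \<times> 'x) set) \<Rightarrow> (nat \<Rightarrow> complex^'x^'x) \<Rightarrow> nat \<Rightarrow> bool" where
  "Q_polynomial_wrt d R E k \<longleftrightarrow> (\<exists>\<sigma>. Q_polynomial_ordering d R E \<sigma> \<and> \<sigma> 1 = k)"

lemma lin_comb_nth: "lin_comb d c M $ x $ y = (\<Sum>i\<le>d. c i * M i $ x $ y)"
  by (simp add: lin_comb_def mscale_def)

lemma lin_comb_diff: "lin_comb d (\<lambda>i. c i - c' i) M = lin_comb d c M - lin_comb d c' M"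
  by (simp add: vec_eq_iff lin_comb_nth left_diff_distrib sum_subtractf)

lemma adjacency_matrix_basis:
  assumes "symmetric_association_scheme d R"
  shows "is_basis d (\<lambda>i. adjacency_matrix (R i)) (bose_mesner d R)"
proof -
  have "c k = 0" if c: "lin_comb d c (\<lambda>i. adjacency_matrix (R i)) = 0" and k: "k \<le> d" for c k
  proof -
    obtain x y where xy: "(x, y) \<in> R k"
      using assms k unfolding symmetric_association_scheme_def by (metis equals0I surj_pair)
    have "(x, y) \<in> R i \<longleftrightarrow> i = k" if "i \<le> d" for i
      using assms k xy that unfolding symmetric_association_scheme_def by (metis disjoint_iff)
    then have "lin_comb d c (\<lambda>i. adjacency_matrix (R i)) $ x $ y = (\<Sum>i\<le>d. if i = k then c i else 0)"
      unfolding lin_comb_nth adjacency_matrix_def by (intro sum.cong) auto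
    then show ?thesis using c k by simp
  qed
  then show ?thesis by (auto simp: is_basis_def bose_mesner_def)
qed

lemma is_basis_ex1:
  assumes "is_basis d M S" and "A \<in> S"
  shows "\<exists>!c. (\<forall>j>d. c j = 0) \<and> A = lin_comb d c M"
proof -
  obtain c where c: "A = lin_comb d c M" using assms unfolding is_basis_def by blast
  have 1: "A = lin_comb d (\<lambda>j. if j \<le> d then c j else 0) M"
    unfolding c lin_comb_def by (intro sum.cong) auto
  show ?thesis
  proof (rule ex1I[of _ "\<lambda>j. if j \<le> d then c j else 0"])
    fix e assume e: "(\<forall>j>d. e j = 0) \<and> A = lin_comb d e M"
    then have "lin_comb d (\<lambda>i. e i - c i) M = 0" using c by (simp add: lin_comb_diff)
    then have "\<forall>i\<le>d. e i - c i = 0" using assms(1) unfolding is_basis_def by fastforce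
    then show "e = (\<lambda>j. if j \<le> d then c j else 0)" using e by auto
  qed (use 1 in auto)
qed

lemma p_num_eq:
  assumes "primitive_idempotents d R E" and "symmetric_association_scheme d R" and "i \<le> d"
  shows "adjacency_matrix (R i) = lin_comb d (p_num d R E i) E"
proof -
  have "adjacency_matrix (R i) = lin_comb d (\<lambda>j. if j = i then 1 else 0) (\<lambda>i. adjacency_matrix (R i))"
    using \<open>i \<le> d\<close> by (simp add: vec_eq_iff lin_comb_nth if_distrib[of "\<lambda>a. a * _"] cong: if_cong)
  then have "adjacency_matrix (R i) \<in> bose_mesner d R" unfolding bose_mesner_def by blast
  then show ?thesis
    using theI'[OF is_basis_ex1[of d E]] assms(1)
    unfolding p_num_def primitive_idempotents_def by blast
qed

lemma q_num_eq:
  fixes E :: "nat \<Rightarrow> complex^'x^'x::finite"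
  assumes "primitive_idempotents d R E" and "symmetric_association_scheme d R" and "i \<le> d"
  shows "E i = mscale (1 / of_nat CARD('x)) (lin_comb d (q_num d R E i) (\<lambda>j. adjacency_matrix (R j)))"
proof -
  let ?n = "of_nat CARD('x) :: complex"
  have n: "A = mscale (1 / ?n) B \<longleftrightarrow> mscale ?n A = B" for A B :: "complex^'x^'x"
    by (auto simp: vec_eq_iff mscale_def field_simps)
  obtain c where c: "E i = lin_comb d c (\<lambda>j. adjacency_matrix (R j))"
    using assms unfolding primitive_idempotents_def primitive_idempotent_def bose_mesner_def by blast
  have "mscale ?n (E i) = lin_comb d (\<lambda>j. ?n * c j) (\<lambda>j. adjacency_matrix (R j))"
    unfolding c by (simp add: vec_eq_iff mscale_def lin_comb_nth sum_distrib_left mult.assoc)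
  then have "mscale ?n (E i) \<in> bose_mesner d R" unfolding bose_mesner_def by blast
  from theI'[OF is_basis_ex1[OF adjacency_matrix_basis[OF assms(2)] this]]
  show ?thesis unfolding q_num_def n by blast
qed

end

theory Submission
  imports Defs "HOL-Library.Complex_Order"
begin

text \<open>Let \<open>L\<^sub>j(f) = \<Sum>\<^sub>k f(k) p\<^sub>k(j)\<close> be the functionals dual to the \<open>q\<^sub>i\<close>, so that
  \<open>L\<^sub>j(q\<^sub>i) = |X| \<delta>\<^sub>i\<^sub>j\<close>. As \<open>p\<^sub>0(l) = 1\<close>, Lagrange interpolation of polynomials of degree
  less than \<open>d\<close> at the nodes \<open>\<theta>\<^sub>1, \<dots>, \<theta>\<^sub>d\<close>, evaluated at \<open>\<theta>\<^sub>0\<close>, shows that condition (2) for \<open>l\<close>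
  says exactly that \<open>L\<^sub>l\<close> kills all polynomials in \<open>\<theta>\<close> of degree less than \<open>d\<close>. For a Q-polynomial
  ordering this holds for \<open>l = i\<^sub>d\<close>, and duality makes such an \<open>l\<close> unique.

  Conversely, draw an arc from \<open>i\<close> to \<open>k\<close> if \<open>L\<^sub>k(q\<^sub>1 q\<^sub>i) \<noteq> 0\<close>. By the Krein condition these numbers are
  nonnegative, so no cancellation occurs and \<open>L\<^sub>k(\<theta>\<^sup>h) \<noteq> 0\<close> iff there is a walk of length \<open>h\<close> from
  \<open>0\<close> to \<open>k\<close>. Condition (2) puts \<open>l\<close> at distance exactly \<open>d\<close> from \<open>0\<close>, so a shortest walk
  to \<open>l\<close> visits all \<open>d + 1\<close> vertices. In this order the expansion of the powers of \<open>\<theta>\<close> in the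
  \<open>q\<^sub>i\<close> is triangular, and inverting it gives the polynomials \<open>v\<^sub>h\<close>.\<close>

section \<open>Matrices and sums\<close>

lemma mscale_nth [simp]: "mscale c M $ x $ y = c * M $ x $ y"
  by (simp add: mscale_def)

lemma mscale_eq_0_iff: "mscale c M = 0 \<longleftrightarrow> c = 0 \<or> M = 0"
  by (auto simp: vec_eq_iff)

lemma mscale_one: "mscale 1 M = M"
  by (simp add: vec_eq_iff)

lemma mscale_mscale: "mscale a (mscale b M) = mscale (a * b) M"
  by (simp add: vec_eq_iff mult.assoc)

lemma mscale_left_cancel:
  assumes "M \<noteq> 0" and "mscale a M = mscale b M"
  shows "a = b"
proof -
  have "mscale (a - b) M = 0" using assms(2) by (simp add: vec_eq_iff left_diff_distrib)
  then show ?thesis using assms(1) by (simp add: mscale_eq_0_iff)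
qed

lemma matrix_mult_nth: "(M ** N) $ x $ y = (\<Sum>z\<in>UNIV. M $ x $ z * N $ z $ y)"
  by (simp add: matrix_matrix_mult_def)

lemma matrix_mult_zero_left: "(0 :: complex^'x^'x::finite) ** N = 0"
  by (simp add: vec_eq_iff matrix_mult_nth)

lemma mscale_matrix_mult: "mscale c M ** N = mscale c (M ** N)"
  by (simp add: vec_eq_iff matrix_mult_nth sum_distrib_left mult.assoc)

lemma matrix_mult_mscale: "M ** mscale c N = mscale c (M ** N)"
  by (simp add: vec_eq_iff matrix_mult_nth sum_distrib_left mult_ac)

lemma lin_comb_matrix_mult: "lin_comb d c M ** N = lin_comb d c (\<lambda>i. M i ** N)"
proof -
  have "(\<Sum>z\<in>UNIV. (\<Sum>i\<le>d. c i * M i $ x $ z) * N $ z $ y) =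
        (\<Sum>i\<le>d. c i * (\<Sum>z\<in>UNIV. M i $ x $ z * N $ z $ y))" for x y
    unfolding sum_distrib_right sum_distrib_left by (subst sum.swap) (simp add: mult.assoc)
  then show ?thesis by (simp add: vec_eq_iff matrix_mult_nth lin_comb_nth)
qed

lemma lin_comb_mscale: "lin_comb d c (\<lambda>i. mscale (e i) N) = mscale (\<Sum>i\<le>d. c i * e i) N"
  by (simp add: vec_eq_iff lin_comb_nth sum_distrib_right mult.assoc)

definition mcnj :: "complex^'x^'x \<Rightarrow> complex^'x^'x::finite" where
  "mcnj M = (\<chi> x y. cnj (M $ x $ y))"

lemma mcnj_nth [simp]: "mcnj M $ x $ y = cnj (M $ x $ y)"
  by (simp add: mcnj_def)

lemma mcnj_mult: "mcnj (M ** N) = mcnj M ** mcnj N"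
  by (simp add: vec_eq_iff matrix_mult_nth)

lemma mcnj_0 [simp]: "mcnj 0 = 0"
  by (simp add: vec_eq_iff)

lemma sum_cmod_square_pos:
  fixes M :: "complex^'x^'x::finite"
  assumes "M \<noteq> 0"
  shows "0 < (\<Sum>x\<in>UNIV. \<Sum>y\<in>UNIV. (cmod (M $ x $ y))\<^sup>2)"
proof -
  obtain x y where "M $ x $ y \<noteq> 0" using assms by (auto simp: vec_eq_iff)
  then have "0 < (\<Sum>y\<in>UNIV. (cmod (M $ x $ y))\<^sup>2)"
    by (intro sum_pos2[of UNIV y]) auto
  then show ?thesis
    by (rule sum_pos2[of UNIV x, rotated 2]) (auto intro: sum_nonneg)
qed

lemma sum_rotate:
  "(\<Sum>x\<in>X. \<Sum>y\<in>Y. \<Sum>u\<in>U. F x y u) = (\<Sum>u\<in>U. \<Sum>x\<in>X. \<Sum>y\<in>Y. F x y u)"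
proof -
  have "(\<Sum>x\<in>X. \<Sum>y\<in>Y. \<Sum>u\<in>U. F x y u) = (\<Sum>x\<in>X. \<Sum>u\<in>U. \<Sum>y\<in>Y. F x y u)"
    by (rule sum.cong[OF refl], rule sum.swap)
  then show ?thesis by (simp only: sum.swap[of _ U X])
qed

lemma sum_product3:
  fixes f g h :: "'a \<Rightarrow> 'b::comm_semiring_0"
  shows "sum f U * sum g V * sum h W = (\<Sum>u\<in>U. \<Sum>v\<in>V. \<Sum>w\<in>W. f u * g v * h w)"
  by (subst sum_product, simp only: sum_distrib_right, simp only: sum_distrib_left)

section \<open>Lagrange interpolation\<close>

text \<open>Each linear factor is normalised separately, so that evaluation at
  \<open>\<theta> 0\<close> gives literally the product in condition (2).\<close>

definition lagrange_basis :: "nat set \<Rightarrow> (nat \<Rightarrow> 'a::field) \<Rightarrow> nat \<Rightarrow> 'a poly" where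
  "lagrange_basis A t i = (\<Prod>j\<in>A - {i}. smult (1 / (t i - t j)) [:- t j, 1:])"

lemma poly_lagrange_basis:
  "poly (lagrange_basis A t i) x = (\<Prod>j\<in>A - {i}. (x - t j) / (t i - t j))"
  by (simp add: lagrange_basis_def poly_prod diff_divide_distrib)

lemma degree_lagrange_basis:
  assumes "finite A" and "i \<in> A"
  shows "degree (lagrange_basis A t i) < card A"
proof -
  have "degree (lagrange_basis A t i) \<le> (\<Sum>j\<in>A - {i}. 1)"
    unfolding lagrange_basis_def
    by (rule order.trans[OF degree_prod_sum_le], use assms in simp, rule sum_mono)
      (auto intro: order.trans[OF degree_smult_le])
  also have "\<dots> < card A" using assms card_gt_0_iff[of A] by auto
  finally show ?thesis .
qed

lemma poly_lagrange_basis_node: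
  assumes "finite A" and "inj_on t A" and "i \<in> A" and "k \<in> A"
  shows "poly (lagrange_basis A t i) (t k) = (if k = i then 1 else 0)"
proof (cases "k = i")
  case True
  have "t i \<noteq> t j" if "j \<in> A - {i}" for j
    using assms(2,3) that by (auto dest: inj_onD)
  then show ?thesis unfolding poly_lagrange_basis True by (simp add: prod.neutral)
next
  case False
  then show ?thesis using assms unfolding poly_lagrange_basis by (auto intro!: bexI[of _ k])
qed

text \<open>Both sides have degree below \<open>card A\<close> in \<open>x\<close> and agree at the
  \<open>card A\<close> distinct nodes.\<close>

lemma lagrange_interpolation:
  fixes t :: "nat \<Rightarrow> 'a::field"
  assumes "finite A" and "inj_on t A" and "degree f < card A"
  shows "poly f x = (\<Sum>i\<in>A. poly f (t i) * poly (lagrange_basis A t i) x)"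
proof -
  let ?g = "\<Sum>i\<in>A. smult (poly f (t i)) (lagrange_basis A t i)"
  have c: "card (t ` A) = card A" using assms by (simp add: card_image)
  have "f = ?g"
  proof (rule poly_eqI_degree[of "t ` A"])
    fix y assume "y \<in> t ` A"
    then obtain k where k: "k \<in> A" "y = t k" by blast
    have "poly ?g y = (\<Sum>i\<in>A. poly f (t i) * (if k = i then 1 else 0))"
      unfolding poly_sum poly_smult k(2)
      by (intro sum.cong refl) (use assms k in \<open>simp add: poly_lagrange_basis_node\<close>)
    then show "poly f y = poly ?g y" using k assms by (simp add: if_distrib cong: if_cong)
  next
    show "card (t ` A) > degree f" using assms c by simp
    show "card (t ` A) > degree ?g" unfolding c
      by (rule degree_sum_less)
        (use assms degree_lagrange_basis degree_smult_le in \<open>auto intro: le_less_trans\<close>)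
  qed
  then have "poly f x = poly ?g x" by simp
  then show ?thesis by (simp add: poly_sum)
qed

section \<open>Shortest walks through all vertices\<close>

text \<open>Backtracking: every member of level \<open>Suc m\<close> has a predecessor in level
  \<open>m\<close>, so the walk is built from its end.\<close>

lemma walk_of_levels:
  fixes S :: "nat \<Rightarrow> 'a set"
  assumes step: "\<And>h. S (Suc h) = {k \<in> V. \<exists>i\<in>S h. N i k}"
    and "l \<in> S m"
  shows "\<exists>w. w m = l \<and> (\<forall>h\<le>m. w h \<in> S h) \<and> (\<forall>h<m. N (w h) (w (Suc h)))"
  using assms(2)
proof (induction m arbitrary: l)
  case 0
  then show ?case by (intro exI[of _ "\<lambda>_. l"]) auto
next
  case (Suc m)
  then obtain i where i: "i \<in> S m" "N i l" by (auto simp: step)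
  then obtain w where w: "w m = i" "\<forall>h\<le>m. w h \<in> S h" "\<forall>h<m. N (w h) (w (Suc h))"
    using Suc.IH by blast
  show ?case
    by (rule exI[of _ "w(Suc m := l)"])
      (use w i Suc.prems in \<open>auto simp: le_Suc_eq less_Suc_eq\<close>)
qed

text \<open>\<open>S h\<close> consists of the vertices reached from \<open>S 0\<close> in exactly
  \<open>h\<close> steps. A walk to a vertex first reached at time \<open>d\<close> repeats no
  vertex, so its \<open>d + 1\<close> vertices are all of \<open>{..d}\<close>, and none of them is
  reached before its turn.\<close>

lemma geodesic_enumeration:
  fixes S :: "nat \<Rightarrow> nat set"
  assumes step: "\<And>h. S (Suc h) = {k \<in> {..d}. \<exists>i\<in>S h. N i k}"
    and sub: "\<And>h. S h \<subseteq> {..d}"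
    and l: "l \<in> S d" and l': "\<And>h. h < d \<Longrightarrow> l \<notin> S h"
  obtains w where "w d = l" and "bij_betw w {..d} {..d}"
    and "\<And>h. h \<le> d \<Longrightarrow> w h \<in> S h" and "\<And>h. h \<le> d \<Longrightarrow> S h \<subseteq> w ` {..h}"
proof -
  obtain w where w: "w d = l" "\<And>h. h \<le> d \<Longrightarrow> w h \<in> S h" "\<And>h. h < d \<Longrightarrow> N (w h) (w (Suc h))"
    using walk_of_levels[OF step l] by auto
  \<comment> \<open>If \<open>w h\<close> is also reached at time \<open>g\<close>, following the
    rest of the walk shifts all later arrival times alike.\<close>
  have shift: "w (h + m) \<in> S (g + m)" if "w h \<in> S g" "h + m \<le> d" for h g m
    using that(2)
  proof (induction m)
    case (Suc m)
    then show ?case using w(3)[of "h + m"] sub[of "h + Suc m"] w(2)[of "h + Suc m"]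
      by (auto simp: step)
  qed (use that in simp)
  \<comment> \<open>An early arrival at \<open>w h\<close> would bring the walk to \<open>l\<close>
    at time \<open>g + (d - h)\<close>, which is less than \<open>d\<close>.\<close>
  have first: "w h \<notin> S g" if "g < h" "h \<le> d" for g h
    using shift[of h g "d - h"] l'[of "g + (d - h)"] w(1) that by auto
  have inj: "inj_on w {..d}"
  proof (rule linorder_inj_onI)
    fix g h assume "g < h" "g \<in> {..d}" "h \<in> {..d}"
    then show "w g \<noteq> w h" using first[of g h] w(2)[of g] by auto
  qed auto
  have "w ` {..d} = {..d}"
    by (rule endo_inj_surj) (use inj w(2) sub in \<open>auto simp: subset_iff\<close>)
  then have bij: "bij_betw w {..d} {..d}" using inj by (simp add: bij_betw_def)
  have "S h \<subseteq> w ` {..h}" if "h \<le> d" for h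
  proof
    fix k assume k: "k \<in> S h"
    then obtain g where "g \<le> d" "k = w g"
      using sub \<open>w ` {..d} = {..d}\<close> by (metis atMost_iff imageE subsetD)
    then show "k \<in> w ` {..h}" using first k by (meson atMost_iff image_eqI not_le_imp_less)
  qed
  then show ?thesis using that w bij by blast
qed

section \<open>Eigenvalues and dual eigenvalues\<close>

locale scheme_with_idempotents =
  fixes d :: nat and R :: "nat \<Rightarrow> ('x::finite \<times> 'x) set" and E :: "nat \<Rightarrow> complex^'x^'x"
    and n :: complex
  assumes n_def: "n = of_nat CARD('x)"
    and scheme: "symmetric_association_scheme d R"
    and idem: "primitive_idempotents d R E"
begin

abbreviation "A i \<equiv> adjacency_matrix (R i)"
abbreviation "p \<equiv> p_num d R E"
abbreviation "q \<equiv> q_num d R E"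

lemma n_nonzero: "n \<noteq> 0"
  by (simp add: n_def)

lemma E_nonzero: "i \<le> d \<Longrightarrow> E i \<noteq> 0"
  using idem unfolding primitive_idempotents_def primitive_idempotent_def by blast

lemma E_mult: "i \<le> d \<Longrightarrow> j \<le> d \<Longrightarrow> E i ** E j = (if i = j then E i else 0)"
  using idem unfolding primitive_idempotents_def by blast

lemma lin_comb_E_mult:
  assumes "j \<le> d"
  shows "lin_comb d c E ** E j = mscale (c j) (E j)"
proof -
  have "lin_comb d c (\<lambda>i. E i ** E j) = lin_comb d (\<lambda>i. if i = j then c i else 0) E"
    unfolding lin_comb_def by (intro sum.cong refl) (use assms in \<open>auto simp: E_mult vec_eq_iff\<close>)
  also have "\<dots> = mscale (c j) (E j)"
    using assms by (simp add: vec_eq_iff lin_comb_nth if_distrib[of "\<lambda>a. a * _"] cong: if_cong)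
  finally show ?thesis by (simp add: lin_comb_matrix_mult)
qed

lemma A_mult_E: "i \<le> d \<Longrightarrow> j \<le> d \<Longrightarrow> A i ** E j = mscale (p i j) (E j)"
  using p_num_eq[OF idem scheme] lin_comb_E_mult by simp

lemma relation_obtain:
  obtains k where "k \<le> d" "(x, y) \<in> R k"
proof -
  have "(x, y) \<in> (\<Union>i\<le>d. R i)" using scheme by (simp add: symmetric_association_scheme_def)
  then show ?thesis using that by blast
qed

lemma relation_nonempty:
  assumes "k \<le> d"
  obtains x y where "(x, y) \<in> R k"
  using scheme assms unfolding symmetric_association_scheme_def by (metis equals0I surj_pair)

lemma A_nth:
  assumes "i \<le> d" and "k \<le> d" and "(x, y) \<in> R k"
  shows "A i $ x $ y = (if i = k then 1 else 0)"
proof -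
  have "(x, y) \<in> R i \<longleftrightarrow> i = k"
    using scheme assms unfolding symmetric_association_scheme_def by (metis disjoint_iff)
  then show ?thesis by (simp add: adjacency_matrix_def)
qed

lemma lin_comb_A_nth:
  assumes "k \<le> d" and "(x, y) \<in> R k"
  shows "lin_comb d c A $ x $ y = c k"
proof -
  have "lin_comb d c A $ x $ y = (\<Sum>i\<le>d. if i = k then c i else 0)"
    unfolding lin_comb_nth by (intro sum.cong refl) (use assms in \<open>auto simp: A_nth\<close>)
  then show ?thesis using assms by simp
qed

lemma E_nth:
  assumes "i \<le> d" and "k \<le> d" and "(x, y) \<in> R k"
  shows "E i $ x $ y = q i k / n"
  by (subst q_num_eq[OF idem scheme assms(1)]) (use assms in \<open>simp add: lin_comb_A_nth n_def\<close>)

lemma lin_comb_A_mult_E: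
  assumes "j \<le> d"
  shows "lin_comb d c A ** E j = mscale (\<Sum>k\<le>d. c k * p k j) (E j)"
proof -
  have "lin_comb d c (\<lambda>i. A i ** E j) = lin_comb d c (\<lambda>i. mscale (p i j) (E j))"
    unfolding lin_comb_def by (intro sum.cong refl) (use assms in \<open>auto simp: A_mult_E\<close>)
  then show ?thesis by (simp add: lin_comb_matrix_mult lin_comb_mscale)
qed

text \<open>Compare the eigenvalues of \<open>mscale n (E i)\<close>, expanded in the adjacency
  matrices, on \<open>E j\<close>. Together with \<open>sum_p_q\<close> this says that the two
  eigenmatrices are inverse up to the factor \<open>n\<close>.\<close>

lemma sum_q_p:
  assumes "i \<le> d" and "j \<le> d"
  shows "(\<Sum>k\<le>d. q i k * p k j) = (if i = j then n else 0)"
proof -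
  have "lin_comb d (q i) A = mscale n (E i)"
    by (subst q_num_eq[OF idem scheme assms(1)]) (simp add: mscale_mscale vec_eq_iff n_def)
  then have "mscale (\<Sum>k\<le>d. q i k * p k j) (E j) = mscale n (E i ** E j)"
    using lin_comb_A_mult_E[OF assms(2), of "q i"] by (simp add: mscale_matrix_mult)
  also have "\<dots> = mscale (if i = j then n else 0) (E j)"
    using assms by (auto simp: E_mult vec_eq_iff)
  finally show ?thesis using E_nonzero[OF assms(2)] mscale_left_cancel by blast
qed

lemma sum_p_q:
  assumes "i \<le> d" and "j \<le> d"
  shows "(\<Sum>k\<le>d. p i k * q k j) = (if i = j then n else 0)"
proof -
  obtain x y where xy: "(x, y) \<in> R j" using relation_nonempty assms by blast
  have "A i $ x $ y = (\<Sum>k\<le>d. p i k * E k $ x $ y)"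
    using p_num_eq[OF idem scheme assms(1)] lin_comb_nth by metis
  also have "\<dots> = (\<Sum>k\<le>d. p i k * q k j) / n"
    unfolding sum_divide_distrib
    by (intro sum.cong refl) (use assms xy in \<open>auto simp: E_nth\<close>)
  finally show ?thesis using A_nth[OF assms xy] n_nonzero by (auto simp: field_simps split: if_splits)
qed

lemma p_0: "j \<le> d \<Longrightarrow> p 0 j = 1"
proof -
  assume j: "j \<le> d"
  have "A 0 = mat 1"
    using scheme by (auto simp: symmetric_association_scheme_def adjacency_matrix_def mat_def vec_eq_iff)
  then have "mscale (p 0 j) (E j) = mscale 1 (E j)"
    using A_mult_E[of 0 j] j by (simp add: mscale_one)
  then show ?thesis using E_nonzero[OF j] mscale_left_cancel by blast
qed

lemma q_0: "j \<le> d \<Longrightarrow> q 0 j = 1"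
proof -
  assume j: "j \<le> d"
  obtain x y where xy: "(x, y) \<in> R j" using relation_nonempty j by blast
  have "E 0 $ x $ y = 1 / n"
    using idem by (simp add: primitive_idempotents_def all_ones_def n_def)
  then show ?thesis using E_nth[of 0 j x y] j xy n_nonzero by simp
qed

section \<open>The Krein condition\<close>

lemma E_sym:
  assumes "i \<le> d"
  shows "E i $ x $ y = E i $ y $ x"
proof -
  obtain k where k: "k \<le> d" "(x, y) \<in> R k" using relation_obtain by blast
  then have "(y, x) \<in> R k"
    using scheme unfolding symmetric_association_scheme_def by (meson symD)
  then show ?thesis using E_nth assms k by simp
qed

text \<open>By the symmetry of \<open>E i\<close>, the trace of this product is the sum of the
  squared moduli of the entries of \<open>E i\<close>.\<close>

lemma mcnj_E_mult_E_nonzero: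
  assumes "i \<le> d"
  shows "mcnj (E i) ** E i \<noteq> 0"
proof
  assume 0: "mcnj (E i) ** E i = 0"
  have "complex_of_real ((cmod (E i $ x $ y))\<^sup>2) = mcnj (E i) $ x $ y * E i $ y $ x" for x y
    using E_sym[OF assms, of x y] by (simp add: complex_norm_square mult.commute del: of_real_power)
  then have "complex_of_real (\<Sum>x\<in>UNIV. \<Sum>y\<in>UNIV. (cmod (E i $ x $ y))\<^sup>2) =
        (\<Sum>x\<in>UNIV. (mcnj (E i) ** E i) $ x $ x)"
    unfolding matrix_mult_nth of_real_sum by simp
  also have "\<dots> = complex_of_real 0" using 0 by simp
  finally show False using sum_cmod_square_pos[OF E_nonzero[OF assms]] by (simp only: of_real_eq_iff)
qed

text \<open>Complex conjugation permutes the primitive idempotents, and fixes each one because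
  \<open>E\<^sub>i\<close> is symmetric and hence not orthogonal to its conjugate.\<close>

lemma E_real:
  assumes i: "i \<le> d"
  shows "E i $ x $ y \<in> \<real>"
proof -
  \<comment> \<open>Adjacency matrices are real, so the Bose-Mesner algebra is closed under
    conjugation.\<close>
  have ex: "\<exists>c. mcnj (E j) = lin_comb d c E" if "j \<le> d" for j
  proof -
    have "E j \<in> bose_mesner d R"
      using idem that by (simp add: primitive_idempotents_def primitive_idempotent_def)
    then obtain e where e: "E j = lin_comb d e A" unfolding bose_mesner_def by (rule rangeE)
    have "mcnj (E j) = lin_comb d (\<lambda>k. cnj (e k)) A"
      unfolding e vec_eq_iff mcnj_nth lin_comb_nth
      by (simp add: adjacency_matrix_def if_distrib[of cnj] cong: if_cong)
    then have "mcnj (E j) \<in> bose_mesner d R" by (simp add: bose_mesner_def)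
    also have "bose_mesner d R = range (\<lambda>c. lin_comb d c E)"
      using idem unfolding primitive_idempotents_def is_basis_def by (metis (no_types))
    finally show ?thesis by blast
  qed
  then obtain c where c: "\<And>j. j \<le> d \<Longrightarrow> mcnj (E j) = lin_comb d (c j) E" by metis
  have F: "mcnj (E j) ** E k = mscale (c j k) (E k)" if "j \<le> d" "k \<le> d" for j k
    using c lin_comb_E_mult that by simp
  have prod: "(mcnj (E j) ** mcnj (E m)) ** E k = mscale (c j k * c m k) (E k)"
    if "j \<le> d" "m \<le> d" "k \<le> d" for j m k
    using that by (simp add: matrix_mul_assoc[symmetric] F matrix_mult_mscale mscale_mscale mult.commute)
  have diag: "c j j \<noteq> 0" if "j \<le> d" for j
    using mcnj_E_mult_E_nonzero[OF that] F[OF that that] by (auto simp: mscale_eq_0_iff)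
  \<comment> \<open>Conjugates of orthogonal idempotents are orthogonal, and the nonzero factor
    \<open>c j j\<close> cancels.\<close>
  have off: "c i j = 0" if "j \<le> d" "j \<noteq> i" for j
  proof -
    have "mcnj (E i) ** mcnj (E j) = 0" using that i by (simp add: mcnj_mult[symmetric] E_mult)
    then have "mscale (c i j * c j j) (E j) = 0"
      using prod[of i j j] that i by (simp add: matrix_mult_zero_left)
    then show ?thesis using diag that E_nonzero by (simp add: mscale_eq_0_iff)
  qed
  \<comment> \<open>Idempotence makes \<open>c i i\<close> a root of \<open>c * c = c\<close>; being
    nonzero, it is 1.\<close>
  have "mcnj (E i) ** mcnj (E i) = mcnj (E i)" using i by (simp add: mcnj_mult[symmetric] E_mult)
  then have "mscale (c i i * c i i) (E i) = mscale (c i i) (E i)" using prod[of i i i] F i by simp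
  then have "c i i * c i i = c i i" using E_nonzero[OF i] mscale_left_cancel by blast
  then have "c i i = 1" using diag i by simp
  then have "mcnj (E i) $ x $ y = (\<Sum>j\<le>d. if j = i then E j $ x $ y else 0)"
    unfolding c[OF i] lin_comb_nth by (intro sum.cong refl) (auto simp: off)
  then show ?thesis using i by (simp add: Reals_cnj_iff)
qed

text \<open>\<open>E i\<close> is a real symmetric idempotent, so each diagonal entry is the sum of
  squares of its row.\<close>

lemma trace_E_pos:
  assumes "i \<le> d"
  obtains t where "t > 0" "(\<Sum>x\<in>UNIV. E i $ x $ x) = complex_of_real t"
proof
  show "0 < (\<Sum>x\<in>UNIV. \<Sum>y\<in>UNIV. (cmod (E i $ x $ y))\<^sup>2)"
    using sum_cmod_square_pos E_nonzero assms by blast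
  have "E i $ x $ x = (\<Sum>y\<in>UNIV. E i $ x $ y * E i $ y $ x)" for x
    using E_mult[of i i] assms by (simp flip: matrix_mult_nth)
  moreover have "E i $ x $ y * E i $ y $ x = complex_of_real ((cmod (E i $ x $ y))\<^sup>2)" for x y
    using E_real[OF assms, of x y] E_sym[OF assms, of x y]
    by (simp add: complex_norm_square Reals_cnj_iff del: of_real_power)
  ultimately show "(\<Sum>x\<in>UNIV. E i $ x $ x) =
      complex_of_real (\<Sum>x\<in>UNIV. \<Sum>y\<in>UNIV. (cmod (E i $ x $ y))\<^sup>2)"
    by simp
qed

text \<open>Expanding each factor as \<open>E(x,y) = \<Sum>\<^sub>u E(x,u) E(u,y)\<close> turns the sum into a sum of squares.\<close>

lemma sum_triple_product_nonneg:
  assumes "a \<le> d" and "b \<le> d" and "c \<le> d"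
  shows "0 \<le> (\<Sum>x\<in>UNIV. \<Sum>y\<in>UNIV. E a $ x $ y * E b $ x $ y * E c $ x $ y)"
proof -
  have split: "E i $ x $ y = (\<Sum>u\<in>UNIV. E i $ x $ u * E i $ y $ u)" if "i \<le> d" for i x y
    using E_mult[of i i] E_sym[of i y] that by (simp flip: matrix_mult_nth)
  \<comment> \<open>For fixed \<open>u\<close>, \<open>v\<close>, \<open>w\<close> the summand
    splits into a factor in \<open>x\<close> and the same factor in \<open>y\<close>.\<close>
  define g where "g u v w x = E a $ x $ u * E b $ x $ v * E c $ x $ w" for u v w x
  have "E a $ x $ y * E b $ x $ y * E c $ x $ y =
      (\<Sum>u\<in>UNIV. \<Sum>v\<in>UNIV. \<Sum>w\<in>UNIV. g u v w x * g u v w y)" for x y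
    unfolding split[OF assms(1), of x y] split[OF assms(2), of x y] split[OF assms(3), of x y]
      sum_product3 g_def
    by (intro sum.cong refl) (simp only: mult_ac)
  then have "(\<Sum>x\<in>UNIV. \<Sum>y\<in>UNIV. E a $ x $ y * E b $ x $ y * E c $ x $ y) =
      (\<Sum>x\<in>UNIV. \<Sum>y\<in>UNIV. \<Sum>u\<in>UNIV. \<Sum>v\<in>UNIV. \<Sum>w\<in>UNIV. g u v w x * g u v w y)"
    by simp
  also have "\<dots> = (\<Sum>u\<in>UNIV. \<Sum>x\<in>UNIV. \<Sum>y\<in>UNIV. \<Sum>v\<in>UNIV. \<Sum>w\<in>UNIV. g u v w x * g u v w y)"
    by (rule sum_rotate)
  also have "\<dots> = (\<Sum>u\<in>UNIV. \<Sum>v\<in>UNIV. \<Sum>x\<in>UNIV. \<Sum>y\<in>UNIV. \<Sum>w\<in>UNIV. g u v w x * g u v w y)"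
    by (rule sum.cong[OF refl], rule sum_rotate)
  also have "\<dots> = (\<Sum>u\<in>UNIV. \<Sum>v\<in>UNIV. \<Sum>w\<in>UNIV. \<Sum>x\<in>UNIV. \<Sum>y\<in>UNIV. g u v w x * g u v w y)"
    by (rule sum.cong[OF refl], rule sum.cong[OF refl], rule sum_rotate)
  also have "\<dots> = (\<Sum>u\<in>UNIV. \<Sum>v\<in>UNIV. \<Sum>w\<in>UNIV. (\<Sum>x\<in>UNIV. g u v w x) * (\<Sum>x\<in>UNIV. g u v w x))"
    by (simp add: sum_product)
  finally have eq: "(\<Sum>x\<in>UNIV. \<Sum>y\<in>UNIV. E a $ x $ y * E b $ x $ y * E c $ x $ y) = \<dots>" .
  have "(\<Sum>x\<in>UNIV. g u v w x) \<in> \<real>" for u v w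
    unfolding g_def using assms by (intro sum_in_Reals Reals_mult E_real)
  then have "0 \<le> (\<Sum>x\<in>UNIV. g u v w x) * (\<Sum>x\<in>UNIV. g u v w x)" for u v w
    by (auto simp: less_eq_complex_def complex_is_Real_iff)
  then show ?thesis unfolding eq by (intro sum_nonneg)
qed

text \<open>The sum is \<open>n\<close> times a Krein parameter: the eigenvalue on
  \<open>E c\<close> of \<open>n\<^sup>2\<close> times the entrywise product of \<open>E a\<close>
  and \<open>E b\<close>. Multiplying by the positive trace of \<open>E c\<close> gives a positive
  multiple of the triple sum.\<close>

theorem krein_nonneg:
  assumes "a \<le> d" and "b \<le> d" and "c \<le> d"
  shows "0 \<le> (\<Sum>k\<le>d. q a k * q b k * p k c)" (is "0 \<le> ?L")
proof -
  let ?T = "\<Sum>x\<in>UNIV. \<Sum>y\<in>UNIV. E a $ x $ y * E b $ x $ y * E c $ x $ y"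
  obtain t where t: "t > 0" "(\<Sum>x\<in>UNIV. E c $ x $ x) = complex_of_real t"
    using trace_E_pos assms by blast
  have H: "lin_comb d (\<lambda>k. q a k * q b k) A $ x $ y = n\<^sup>2 * (E a $ x $ y * E b $ x $ y)" for x y
  proof -
    obtain k where "k \<le> d" "(x, y) \<in> R k" using relation_obtain by blast
    then show ?thesis using assms by (simp add: lin_comb_A_nth E_nth power2_eq_square n_nonzero)
  qed
  have "?L * E c $ x $ x = (\<Sum>y\<in>UNIV. n\<^sup>2 * (E a $ x $ y * E b $ x $ y) * E c $ x $ y)" for x
  proof -
    have "?L * E c $ x $ x = (lin_comb d (\<lambda>k. q a k * q b k) A ** E c) $ x $ x"
      using lin_comb_A_mult_E[OF assms(3)] by simp
    then show ?thesis using E_sym[OF assms(3)] by (simp add: matrix_mult_nth H)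
  qed
  then have "?L * (\<Sum>x\<in>UNIV. E c $ x $ x) = n\<^sup>2 * ?T"
    by (simp add: sum_distrib_left mult.assoc)
  then have "?L = complex_of_real ((real CARD('x))\<^sup>2 / t) * ?T"
    using t by (simp add: field_simps n_def)
  moreover have "0 \<le> complex_of_real ((real CARD('x))\<^sup>2 / t)"
    using t by (simp add: less_eq_complex_def)
  ultimately show ?thesis using sum_triple_product_nonneg[OF assms] by (simp only: mult_nonneg_nonneg)
qed

section \<open>Coordinates with respect to the idempotents\<close>

text \<open>A function \<open>f\<close> on \<open>{0..d}\<close> stands for the matrix \<open>\<Sum>\<^sub>k f k A\<^sub>k\<close>;
  \<open>coord j f\<close> is its eigenvalue on \<open>E\<^sub>j\<close>.\<close>

definition coord :: "nat \<Rightarrow> (nat \<Rightarrow> complex) \<Rightarrow> complex" where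
  "coord j f = (\<Sum>k\<le>d. f k * p k j)"

lemma coord_cong: "(\<And>k. k \<le> d \<Longrightarrow> f k = g k) \<Longrightarrow> coord j f = coord j g"
  by (simp add: coord_def)

lemma coord_scale: "coord j (\<lambda>k. a * f k) = a * coord j f"
  by (simp add: coord_def sum_distrib_left mult.assoc)

lemma coord_add: "coord j (\<lambda>k. f k + g k) = coord j f + coord j g"
  by (simp add: coord_def distrib_right sum.distrib)

lemma coord_sum: "coord j (\<lambda>k. \<Sum>i\<in>I. f i k) = (\<Sum>i\<in>I. coord j (f i))"
  unfolding coord_def sum_distrib_right by (rule sum.swap)

lemma coord_q: "i \<le> d \<Longrightarrow> j \<le> d \<Longrightarrow> coord j (q i) = (if i = j then n else 0)"
  by (simp add: coord_def sum_q_p)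

text \<open>Inverts the definition of \<open>coord\<close> by means of
  \<open>sum_p_q\<close>.\<close>

lemma coord_expansion:
  assumes "k \<le> d"
  shows "n * f k = (\<Sum>j\<le>d. coord j f * q j k)"
proof -
  have "(\<Sum>j\<le>d. coord j f * q j k) = (\<Sum>i\<le>d. f i * (\<Sum>j\<le>d. p i j * q j k))"
    unfolding coord_def sum_distrib_right sum_distrib_left
    by (subst sum.swap) (simp add: mult.assoc)
  also have "\<dots> = (\<Sum>i\<le>d. if i = k then n * f i else 0)"
    by (intro sum.cong refl) (use assms in \<open>auto simp: sum_p_q\<close>)
  finally show ?thesis using assms by simp
qed

lemma coord_poly:
  "coord j (\<lambda>k. poly f (t k)) = (\<Sum>h\<le>degree f. coeff f h * coord j (\<lambda>k. t k ^ h))"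
  unfolding poly_altdef coord_sum coord_scale ..

text \<open>Isolates the term at 0, where \<open>p 0 j = 1\<close>, to match interpolation at the
  nodes 1 to \<open>d\<close> evaluated at \<open>\<theta> 0\<close>.\<close>

lemma coord_split: "j \<le> d \<Longrightarrow> coord j f = f 0 + (\<Sum>k=1..d. f k * p k j)"
  by (simp add: coord_def p_0 atMost_atLeast0 sum.atLeast_Suc_atMost)

end

section \<open>Q-polynomial orderings\<close>

locale scheme_with_distinct_duals = scheme_with_idempotents +
  fixes \<theta> :: "nat \<Rightarrow> complex"
  assumes d_ge: "d \<ge> 2"
    and theta: "\<And>j. j \<le> d \<Longrightarrow> \<theta> j = q 1 j"
    and inj: "inj_on \<theta> {0..d}"
begin

section \<open>Condition (2) and moments of the dual eigenvalues\<close>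

definition last_condition :: "nat \<Rightarrow> bool" where
  "last_condition l \<longleftrightarrow>
     (\<forall>i\<in>{1..d}. (\<Prod>j\<in>{1..d} - {i}. (\<theta> 0 - \<theta> j) / (\<theta> i - \<theta> j)) = - p i l)"

text \<open>Up to the factor \<open>n\<close>, the coefficient of \<open>q j\<close> in the
  \<open>h\<close>-th power of \<open>\<theta>\<close>.\<close>

abbreviation "moment j h \<equiv> coord j (\<lambda>k. \<theta> k ^ h)"

lemma inj_pos: "inj_on \<theta> {1..d}"
  using inj by (rule inj_on_subset) auto

lemma moment_0: "j \<le> d \<Longrightarrow> moment j 0 = (if j = 0 then n else 0)"
  using coord_q[of 0 j] coord_cong[of "q 0" "\<lambda>_. 1" j] by (simp add: q_0)

lemma moment_1: "j \<le> d \<Longrightarrow> moment j 1 = (if j = 1 then n else 0)"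
  using coord_q[of 1 j] coord_cong[of "q 1" \<theta> j] d_ge by (auto simp: theta)

text \<open>Expand the \<open>h\<close>-th power in the \<open>q i\<close> and multiply by
  \<open>q 1\<close>: the coefficients are the arc weights of the digraph.\<close>

lemma moment_Suc:
  assumes "k \<le> d"
  shows "n * moment k (Suc h) = (\<Sum>i\<le>d. moment i h * coord k (\<lambda>j. q 1 j * q i j))"
proof -
  have "n * moment k (Suc h) = coord k (\<lambda>j. \<theta> j * (n * \<theta> j ^ h))"
    by (simp add: mult_ac flip: coord_scale)
  also have "\<dots> = coord k (\<lambda>j. \<Sum>i\<le>d. moment i h * (q 1 j * q i j))"
  proof (rule coord_cong)
    fix j assume "j \<le> d"
    then show "\<theta> j * (n * \<theta> j ^ h) = (\<Sum>i\<le>d. moment i h * (q 1 j * q i j))"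
      unfolding theta[OF \<open>j \<le> d\<close>, symmetric] coord_expansion[OF \<open>j \<le> d\<close>, of "\<lambda>j. \<theta> j ^ h"]
      by (simp add: sum_distrib_left mult_ac)
  qed
  finally show ?thesis by (simp add: coord_sum coord_scale)
qed

lemma moment_nonneg: "k \<le> d \<Longrightarrow> 0 \<le> moment k h"
proof (induction h arbitrary: k)
  case 0
  then show ?case unfolding moment_0[OF 0] by (simp add: n_def less_eq_complex_def)
next
  case (Suc h)
  have "0 \<le> (\<Sum>i\<le>d. moment i h * coord k (\<lambda>j. q 1 j * q i j))"
    using Suc krein_nonneg[of 1 _ k] d_ge by (intro sum_nonneg mult_nonneg_nonneg) (auto simp: coord_def)
  then have "0 \<le> n * moment k (Suc h)" using moment_Suc Suc.prems by simp
  then show ?case by (simp add: n_def less_eq_complex_def zero_le_mult_iff)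
qed

text \<open>All terms in the recursion are nonnegative, so nothing cancels and the supports of the
  moments grow along arcs.\<close>

lemma moment_Suc_nonzero_iff:
  assumes "k \<le> d"
  shows "moment k (Suc h) \<noteq> 0 \<longleftrightarrow>
    (\<exists>i\<le>d. moment i h \<noteq> 0 \<and> coord k (\<lambda>j. q 1 j * q i j) \<noteq> 0)"
proof -
  have "moment k (Suc h) = 0 \<longleftrightarrow> (\<Sum>i\<le>d. moment i h * coord k (\<lambda>j. q 1 j * q i j)) = 0"
    using moment_Suc[OF assms, of h] n_nonzero by auto
  also have "\<dots> \<longleftrightarrow> (\<forall>i\<le>d. moment i h * coord k (\<lambda>j. q 1 j * q i j) = 0)"
    using moment_nonneg krein_nonneg[of 1 _ k] d_ge assms
    by (subst sum_nonneg_eq_0_iff) (auto simp: coord_def intro!: mult_nonneg_nonneg)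
  finally show ?thesis by auto
qed

section \<open>Condition (2) as annihilation of low degrees\<close>

lemma last_condition_kills:
  assumes l: "l \<le> d" "last_condition l" and "degree f < d"
  shows "coord l (\<lambda>k. poly f (\<theta> k)) = 0"
proof -
  have "poly f (\<theta> 0) = (\<Sum>i\<in>{1..d}. poly f (\<theta> i) * poly (lagrange_basis {1..d} \<theta> i) (\<theta> 0))"
    using lagrange_interpolation[of "{1..d}" \<theta> f "\<theta> 0"] inj_pos assms(3) by simp
  also have "\<dots> = (\<Sum>i=1..d. poly f (\<theta> i) * (- p i l))"
    using l(2) unfolding last_condition_def poly_lagrange_basis by (intro sum.cong refl) metis
  finally have "poly f (\<theta> 0) = (\<Sum>i=1..d. poly f (\<theta> i) * (- p i l))" .
  then show ?thesis using l by (simp add: coord_split sum_negf)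
qed

text \<open>Test on the Lagrange basis polynomial of node \<open>i\<close>: only the terms at 0 and
  at \<open>i\<close> survive.\<close>

lemma kills_last_condition:
  assumes l: "l \<le> d" and kills: "\<And>f. degree f < d \<Longrightarrow> coord l (\<lambda>k. poly f (\<theta> k)) = 0"
  shows "last_condition l"
  unfolding last_condition_def
proof
  fix i assume i: "i \<in> {1..d}"
  let ?f = "lagrange_basis {1..d} \<theta> i"
  have "(\<Sum>k=1..d. poly ?f (\<theta> k) * p k l) = (\<Sum>k=1..d. if k = i then p k l else 0)"
    by (intro sum.cong refl) (use i inj_pos in \<open>simp add: poly_lagrange_basis_node\<close>)
  then have "coord l (\<lambda>k. poly ?f (\<theta> k)) = poly ?f (\<theta> 0) + p i l"
    using i l by (simp add: coord_split)
  moreover have "coord l (\<lambda>k. poly ?f (\<theta> k)) = 0"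
    by (rule kills) (use degree_lagrange_basis[of "{1..d}" i] i in simp)
  ultimately show "(\<Prod>j\<in>{1..d} - {i}. (\<theta> 0 - \<theta> j) / (\<theta> i - \<theta> j)) = - p i l"
    by (simp add: poly_lagrange_basis eq_neg_iff_add_eq_0)
qed

text \<open>The condition together with \<open>p_0\<close> determines column \<open>l\<close> of the
  eigenmatrix, and \<open>coord_q\<close> separates the columns.\<close>

lemma last_condition_unique:
  assumes "l \<le> d" "m \<le> d" "last_condition l" "last_condition m"
  shows "l = m"
proof -
  have "p k l = p k m" if "k \<le> d" for k
    using assms that p_0 by (cases "k = 0") (auto simp: last_condition_def)
  then have "coord l (q l) = coord m (q l)" by (simp add: coord_def)
  then show ?thesis using assms n_nonzero by (auto simp: coord_q split: if_splits)
qed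

text \<open>The coordinate at \<open>\<sigma> d\<close> vanishes on every
  \<open>q (\<sigma> m)\<close> with \<open>m < d\<close>; the polynomials representing these have
  degrees 0 to \<open>d - 1\<close> and hence span all polynomials of degree less than
  \<open>d\<close>.\<close>

lemma ordering_last_condition:
  assumes "Q_polynomial_ordering d R E \<sigma>" and \<sigma>1: "\<sigma> 1 = 1"
  shows "last_condition (\<sigma> d)" and "\<sigma> d \<in> {2..d}"
proof -
  have bij: "bij_betw \<sigma> {..d} {..d}" and \<sigma>0: "\<sigma> 0 = 0"
    and ex: "\<And>h. h \<le> d \<Longrightarrow> \<exists>v. degree v = h \<and> (\<forall>j\<le>d. q (\<sigma> h) j = poly v (q 1 j))"
    using assms unfolding Q_polynomial_ordering_def by auto
  have le: "\<sigma> h \<le> d" if "h \<le> d" for h using bij that by (auto dest: bij_betwE)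
  have eq: "\<sigma> g = \<sigma> h \<longleftrightarrow> g = h" if "g \<le> d" "h \<le> d" for g h
    using bij that by (auto simp: bij_betw_def inj_on_eq_iff)
  show "\<sigma> d \<in> {2..d}"
    using le[of d] eq[of d 0] eq[of d 1] \<sigma>0 \<sigma>1 d_ge by (cases "\<sigma> d = 0"; cases "\<sigma> d = 1") auto
  \<comment> \<open>Bounding the coefficients instead of the degree makes the base case
    \<open>m = 0\<close> the zero polynomial.\<close>
  have kill: "coord (\<sigma> d) (\<lambda>k. poly f (\<theta> k)) = 0" if "\<forall>i\<ge>m. coeff f i = 0" "m \<le> d" for f m
    using that
  proof (induction m arbitrary: f)
    case 0
    then have "f = 0" by (simp add: poly_eq_iff)
    then show ?case by (simp add: coord_def)
  next
    case (Suc m)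
    obtain v where v: "degree v = m" "\<And>j. j \<le> d \<Longrightarrow> q (\<sigma> m) j = poly v (\<theta> j)"
      using ex[of m] theta Suc.prems by auto
    have "v \<noteq> 0"
    proof
      assume "v = 0"
      then have "coord (\<sigma> m) (q (\<sigma> m)) = 0" using v by (simp add: coord_def)
      then show False using coord_q[of "\<sigma> m" "\<sigma> m"] le[of m] Suc.prems n_nonzero by simp
    qed
    \<comment> \<open>Chosen so that subtracting \<open>smult a v\<close> removes the coefficient at
      \<open>m\<close>.\<close>
    define a where "a = coeff f m / lead_coeff v"
    define g where "g = f - smult a v"
    have "coeff g i = 0" if "i \<ge> m" for i
    proof (cases "i = m")
      case True
      then show ?thesis using leading_coeff_neq_0[OF \<open>v \<noteq> 0\<close>] v(1) by (simp add: g_def a_def)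
    next
      case False
      then show ?thesis using v Suc.prems that by (simp add: g_def coeff_eq_0)
    qed
    then have "coord (\<sigma> d) (\<lambda>k. poly g (\<theta> k)) = 0" using Suc by simp
    moreover have "coord (\<sigma> d) (\<lambda>k. poly v (\<theta> k)) = 0"
      using coord_cong[of "q (\<sigma> m)" "\<lambda>k. poly v (\<theta> k)" "\<sigma> d"] v coord_q[of "\<sigma> m" "\<sigma> d"]
        le[of m] le[of d] eq[of m d] Suc.prems by simp
    moreover have "poly f x = poly g x + a * poly v x" for x by (simp add: g_def)
    ultimately show ?case by (simp add: coord_add coord_scale)
  qed
  show "last_condition (\<sigma> d)"
  proof (rule kills_last_condition)
    fix f :: "complex poly" assume "degree f < d"
    then show "coord (\<sigma> d) (\<lambda>k. poly f (\<theta> k)) = 0" by (intro kill[of d]) (auto simp: coeff_eq_0)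
  qed (use le in simp)
qed

section \<open>From condition (2) to an ordering\<close>

lemma last_condition_moment:
  assumes "l \<le> d" "last_condition l"
  shows "h < d \<Longrightarrow> moment l h = 0" and "moment l d \<noteq> 0"
proof -
  show 0: "moment l h = 0" if "h < d" for h
    using last_condition_kills[OF assms, of "monom 1 h"] that by (simp add: degree_monom_eq poly_monom)
  \<comment> \<open>This polynomial vanishes at all nodes but \<open>\<theta> 0\<close>, so its
    coordinate at \<open>l\<close> is its nonzero value there; only its term of degree
    \<open>d\<close> can account for that.\<close>
  let ?f = "\<Prod>j=1..d. [:- \<theta> j, 1:]"
  have deg: "degree ?f = d" by (subst degree_prod_sum_eq) auto
  have "poly ?f (\<theta> k) = 0" if "k \<in> {1..d}" for k
    using that by (auto simp: poly_prod)
  then have "coord l (\<lambda>k. poly ?f (\<theta> k)) = poly ?f (\<theta> 0)"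
    using assms by (simp add: coord_split)
  also have "\<dots> \<noteq> 0"
    using inj by (auto simp: poly_prod dest: inj_onD[where x = 0])
  finally have "coord l (\<lambda>k. poly ?f (\<theta> k)) \<noteq> 0" .
  then obtain h where "h \<le> d" "moment l h \<noteq> 0"
    unfolding coord_poly deg by (metis (no_types, lifting) atMost_iff mult_zero_right sum.neutral)
  then show "moment l d \<noteq> 0" using 0[of h] by (cases "h = d") auto
qed

text \<open>The \<open>h\<close>-th power of \<open>\<theta>\<close> involves only the
  \<open>q (\<sigma> g)\<close> with \<open>g \<le> h\<close>, with nonzero coefficient at
  \<open>g = h\<close>, so \<open>q (\<sigma> h)\<close> can be solved for recursively.\<close>

lemma triangular_moments_ordering:
  assumes bij: "bij_betw \<sigma> {..d} {..d}" and \<sigma>1: "\<sigma> 1 = 1" and \<sigma>0: "\<sigma> 0 = 0"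
    and nz: "\<And>h. h \<le> d \<Longrightarrow> moment (\<sigma> h) h \<noteq> 0"
    and tri: "\<And>g h. h < g \<Longrightarrow> g \<le> d \<Longrightarrow> moment (\<sigma> g) h = 0"
  shows "Q_polynomial_ordering d R E \<sigma>"
proof -
  have "\<exists>v. degree v = h \<and> (\<forall>j\<le>d. q (\<sigma> h) j = poly v (\<theta> j))" if "h \<le> d" for h
    using that
  proof (induction h rule: less_induct)
    case (less h)
    then have "\<forall>g\<in>{..<h}. \<exists>v. degree v = g \<and> (\<forall>j\<le>d. q (\<sigma> g) j = poly v (\<theta> j))" by auto
    then obtain v where v: "\<And>g. g < h \<Longrightarrow> degree (v g) = g"
      "\<And>g j. g < h \<Longrightarrow> j \<le> d \<Longrightarrow> q (\<sigma> g) j = poly (v g) (\<theta> j)"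
      by (auto dest!: bchoice)
    \<comment> \<open>\<open>r\<close> collects the lower terms already known as polynomials;
      \<open>u\<close> is the solution for \<open>q (\<sigma> h)\<close>, of exact degree
      \<open>h\<close> since \<open>r\<close> has no terms from \<open>h\<close> on.\<close>
    define r where "r = (\<Sum>g<h. smult (moment (\<sigma> g) h) (v g))"
    define u where "u = smult (1 / moment (\<sigma> h) h) (monom n h - r)"
    have "coeff r i = 0" if "i \<ge> h" for i
      unfolding r_def coeff_sum by (intro sum.neutral) (use v that in \<open>auto simp: coeff_eq_0\<close>)
    then have "degree (monom n h - r) = h"
      using n_nonzero by (intro antisym degree_le le_degree) auto
    then have "degree u = h" using nz less.prems by (simp add: u_def)
    moreover have "q (\<sigma> h) j = poly u (\<theta> j)" if j: "j \<le> d" for j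
    proof -
      have "n * \<theta> j ^ h = (\<Sum>k\<le>d. moment k h * q k j)"
        using coord_expansion[OF j, of "\<lambda>k. \<theta> k ^ h"] by simp
      also have "\<dots> = (\<Sum>g\<le>d. moment (\<sigma> g) h * q (\<sigma> g) j)"
        by (rule sum.reindex_bij_betw[OF bij, symmetric])
      also have "\<dots> = (\<Sum>g\<le>h. moment (\<sigma> g) h * q (\<sigma> g) j)"
        by (rule sum.mono_neutral_right) (use tri less.prems in auto)
      also have "\<dots> = (\<Sum>g<h. moment (\<sigma> g) h * q (\<sigma> g) j) + moment (\<sigma> h) h * q (\<sigma> h) j"
        by (simp flip: lessThan_Suc_atMost)
      also have "(\<Sum>g<h. moment (\<sigma> g) h * q (\<sigma> g) j) = poly r (\<theta> j)"
        using v j by (simp add: r_def poly_sum)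
      finally show ?thesis using nz[OF less.prems] by (simp add: u_def poly_monom field_simps)
    qed
    ultimately show ?case by blast
  qed
  then show ?thesis using bij \<sigma>0 \<sigma>1 theta by (simp add: Q_polynomial_ordering_def)
qed

text \<open>The supports of the moments are the levels of the digraph; the shortest walk to
  \<open>l\<close> supplies the ordering.\<close>

lemma last_condition_ordering:
  assumes "l \<le> d" "last_condition l"
  shows "Q_polynomial_wrt d R E 1"
proof -
  let ?S = "\<lambda>h. {k \<in> {..d}. moment k h \<noteq> 0}"
  obtain w where w: "bij_betw w {..d} {..d}" "\<And>h. h \<le> d \<Longrightarrow> w h \<in> ?S h"
    "\<And>h. h \<le> d \<Longrightarrow> ?S h \<subseteq> w ` {..h}"
  proof (rule geodesic_enumeration[of ?S d "\<lambda>i k. coord k (\<lambda>j. q 1 j * q i j) \<noteq> 0" l])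
    show "?S (Suc h) = {k \<in> {..d}. \<exists>i\<in>?S h. coord k (\<lambda>j. q 1 j * q i j) \<noteq> 0}" for h
      using moment_Suc_nonzero_iff by auto
  qed (use last_condition_moment[OF assms] assms(1) in auto)
  have "moment (w g) h = 0" if "h < g" "g \<le> d" for g h
  proof (rule ccontr)
    assume "moment (w g) h \<noteq> 0"
    moreover have "w g \<le> d" using w(1) that by (auto dest: bij_betwE)
    ultimately have "w g \<in> w ` {..h}" using w(3)[of h] that by auto
    then obtain g' where "g' \<le> h" "w g = w g'" by auto
    then show False using w(1) that by (auto simp: bij_betw_def inj_on_eq_iff)
  qed
  \<comment> \<open>The moments of order 0 and 1 are supported at the single vertices 0 and
    1.\<close>
  moreover have "w 0 = 0" "w 1 = 1"
    using w(2)[of 0] w(2)[of 1] d_ge moment_0[of "w 0"] moment_1[of "w 1"]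
    by (auto split: if_splits)
  ultimately show ?thesis
    using triangular_moments_ordering[of w] w(1,2) unfolding Q_polynomial_wrt_def by blast
qed

theorem Q_polynomial_iff_last_condition:
  "(Q_polynomial_wrt d R E 1 \<longleftrightarrow> (\<exists>l\<in>{2..d}. last_condition l)) \<and>
   (\<forall>l\<in>{2..d}. last_condition l \<longrightarrow>
      (\<forall>\<sigma>. Q_polynomial_ordering d R E \<sigma> \<and> \<sigma> 1 = 1 \<longrightarrow> l = \<sigma> d))"
proof (intro conjI iffI ballI allI impI)
  assume "Q_polynomial_wrt d R E 1"
  then show "\<exists>l\<in>{2..d}. last_condition l"
    using ordering_last_condition unfolding Q_polynomial_wrt_def by blast
next
  assume "\<exists>l\<in>{2..d}. last_condition l"
  then show "Q_polynomial_wrt d R E 1" using last_condition_ordering by auto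
next
  fix l \<sigma>
  assume "l \<in> {2..d}" "last_condition l" "Q_polynomial_ordering d R E \<sigma> \<and> \<sigma> 1 = 1"
  then show "l = \<sigma> d" using ordering_last_condition[of \<sigma>] last_condition_unique by auto
qed

end

theorem theorem1p1:
  fixes d :: nat
    and R :: "nat \<Rightarrow> ('x::finite \<times> 'x) set"
    and E :: "nat \<Rightarrow> complex^'x^'x"
    and \<theta> :: "nat \<Rightarrow> complex"
  assumes "d \<ge> 2"
    and "symmetric_association_scheme d R"
    and "primitive_idempotents d R E"
    and "\<And>j. j \<le> d \<Longrightarrow> \<theta> j = q_num d R E 1 j"
    and "inj_on \<theta> {0..d}"
  shows "(Q_polynomial_wrt d R E 1 \<longleftrightarrow>
            (\<exists>l\<in>{2..d}. \<forall>i\<in>{1..d}.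
               (\<Prod>j\<in>{1..d} - {i}. (\<theta> 0 - \<theta> j) / (\<theta> i - \<theta> j)) = - p_num d R E i l)) \<and>
         (\<forall>l\<in>{2..d}.
            (\<forall>i\<in>{1..d}. (\<Prod>j\<in>{1..d} - {i}. (\<theta> 0 - \<theta> j) / (\<theta> i - \<theta> j)) = - p_num d R E i l) \<longrightarrow>
            (\<forall>\<sigma>. Q_polynomial_ordering d R E \<sigma> \<and> \<sigma> 1 = 1 \<longrightarrow> l = \<sigma> d))"
proof -
  interpret scheme_with_distinct_duals d R E "of_nat CARD('x)" \<theta>
    using assms by unfold_locales auto
  show ?thesis
    using Q_polynomial_iff_last_condition unfolding last_condition_def .
qed

end
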